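(* Assume that $\Omega$ is convex and let $V\subset\Omega$ have finite cardinality. Then $$s^*(V)\le2\sqrt d\,\inf_{\mu\in\mathcal P_c(\Omega)}\ \inf_{\nu\in\mathcal P(V)}d_\infty(\mu,\nu).$$
   Context: $d\in\mathbb N=\{1,2,\dots\}$ and $\Omega\subset\mathbb R^d$ is open and bounded with Lipschitz boundary. For $s\ge0$, $\mathbb G_s(V)$ is the simple graph with vertex set $V$ in which two distinct vertices $x,y$ are adjacent iff $|x-y|\le s$. The connectivity threshold $s^*(V)$ is the infimum over all $s\ge0$ such that $\mathbb G_s(V)$ is connected. $\mathcal P_c(\Omega)$ is the set of Borel probability measures on $\Omega$ that are equivalent to Lebesgue measure on $\Omega$ (each absolutely continuous with respect to the other). $\mathcal P(V)$ is the set of probability measures supported on $V$. The $\infty$-Wasserstein distance between probability measures $\mu,\nu$ on $\Omega$ is $$d_\infty(\mu,\nu):=\inf_{\gamma\in\Gamma(\mu,\nu)}\operatorname{esssup}_{(\Omega\times\Omega,\gamma)}\{(x,y)\mapsto|x-y|\},$$ where $\Gamma(\mu,\nu)$ is the set of couplings of $\mu$ and $\nu$ (probability measures on $\Omega\times\Omega$ with marginals $\mu$ and $\nu$) and $\operatorname{esssup}$ is the usual essential supremum with respect to $\gamma$. *)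

theory Defs
  imports
    "HOL-Probability.Probability"
    "Graph_Theory.Digraph_Component"
begin

text \<open>
  A bounded open set has Lipschitz boundary if near each boundary point it is, in a suitable
  orthonormal frame whose last axis is \<open>e\<close>, the strict subgraph of a Lipschitz function \<open>g\<close> on the
  hyperplane orthogonal to \<open>e\<close>. The term \<open>y - (y \<bullet> e) *\<^sub>R e\<close> is the orthogonal projection of \<open>y\<close>
  onto that hyperplane.
\<close>

definition lipschitz_boundary :: "'a::euclidean_space set \<Rightarrow> bool" where
  "lipschitz_boundary \<Omega> \<longleftrightarrow>
     (\<forall>x \<in> frontier \<Omega>. \<exists>r>0. \<exists>e g L. norm e = 1 \<and> L-lipschitz_on {z. z \<bullet> e = 0} g \<and>
        \<Omega> \<inter> ball x r = {y \<in> ball x r. y \<bullet> e < (g (y - (y \<bullet> e) *\<^sub>R e) :: real)})"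

text \<open>
  A simple graph is represented by its set of ordered pairs of adjacent vertices, that is, as a
  loop-free symmetric digraph without multiple arcs.
\<close>

definition geometric_graph :: "real \<Rightarrow> 'a::metric_space set \<Rightarrow> 'a pair_pre_digraph" where
  "geometric_graph s V =
     \<lparr> pverts = V, parcs = {(x, y). x \<in> V \<and> y \<in> V \<and> x \<noteq> y \<and> dist x y \<le> s} \<rparr>"

lemma pair_graph_geometric_graph:
  assumes "finite V"
  shows "pair_graph (geometric_graph s V)"
proof
  show "finite (parcs (geometric_graph s V))"
    by (rule finite_subset[of _ "V \<times> V"]) (auto simp: geometric_graph_def assms)
qed (auto simp: geometric_graph_def assms symmetric_def sym_def dist_commute)

text \<open>
  Thresholds and distances take values in \<^typ>\<open>ennreal\<close>, so an infimum over the empty set is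
  \<open>\<infinity>\<close>. In \<^const>\<open>Digraph_Component.connected\<close> the graph without vertices is not connected, so the
  threshold of the empty set is \<open>\<infinity>\<close>.
\<close>

definition connectivity_threshold :: "'a::metric_space set \<Rightarrow> ennreal" where
  "connectivity_threshold V =
     Inf {ennreal s | s. 0 \<le> s \<and> Digraph_Component.connected (with_proj (geometric_graph s V))}"

definition borel_prob_measures :: "'a::topological_space set \<Rightarrow> 'a measure set" where
  "borel_prob_measures \<Omega> = {\<mu>. prob_space \<mu> \<and> space \<mu> = \<Omega> \<and> sets \<mu> = sets (restrict_space borel \<Omega>)}"

definition equivalent_prob_measures :: "'a::euclidean_space set \<Rightarrow> 'a measure set" where
  "equivalent_prob_measures \<Omega> = {\<mu> \<in> borel_prob_measures \<Omega>.
     absolutely_continuous (restrict_space lborel \<Omega>) \<mu> \<and>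
     absolutely_continuous \<mu> (restrict_space lborel \<Omega>)}"

definition supported_prob_measures :: "'a::topological_space set \<Rightarrow> 'a set \<Rightarrow> 'a measure set" where
  "supported_prob_measures \<Omega> V = {\<nu> \<in> borel_prob_measures \<Omega>. AE x in \<nu>. x \<in> V}"

definition couplings :: "'a measure \<Rightarrow> 'b measure \<Rightarrow> ('a \<times> 'b) measure set" where
  "couplings \<mu> \<nu> = {\<gamma>. prob_space \<gamma> \<and> sets \<gamma> = sets (\<mu> \<Otimes>\<^sub>M \<nu>) \<and>
     distr \<gamma> \<mu> fst = \<mu> \<and> distr \<gamma> \<nu> snd = \<nu>}"

definition wasserstein_infinity :: "'a::metric_space measure \<Rightarrow> 'a measure \<Rightarrow> ennreal" where
  "wasserstein_infinity \<mu> \<nu> = (INF \<gamma> \<in> couplings \<mu> \<nu>. esssup \<gamma> (\<lambda>(x, y). ennreal (dist x y)))"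

text \<open>
  The library sets \<^const>\<open>esssup\<close> to \<open>\<infinity>\<close> for functions that are not Borel measurable. The
  next lemma shows that this case does not arise for couplings of Borel measures on \<open>\<Omega>\<close>.
\<close>

lemma borel_measurable_dist_coupling:
  fixes \<Omega> :: "'a::{metric_space, second_countable_topology} set"
  assumes "\<mu> \<in> borel_prob_measures \<Omega>" "\<nu> \<in> borel_prob_measures \<Omega>" "\<gamma> \<in> couplings \<mu> \<nu>"
  shows "(\<lambda>(x, y). ennreal (dist x y)) \<in> borel_measurable \<gamma>"
proof -
  have "sets \<mu> = sets (restrict_space borel \<Omega>)" "sets \<nu> = sets (restrict_space borel \<Omega>)"
    and \<gamma>: "sets \<gamma> = sets (\<mu> \<Otimes>\<^sub>M \<nu>)"
    using assms by (auto simp: borel_prob_measures_def couplings_def)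
  then have [measurable]: "(\<lambda>x. x) \<in> measurable \<mu> borel" "(\<lambda>x. x) \<in> measurable \<nu> borel"
    by (auto simp: measurable_restrict_space1 cong: measurable_cong_sets)
  have "(\<lambda>p. ennreal (dist (fst p) (snd p))) \<in> borel_measurable (\<mu> \<Otimes>\<^sub>M \<nu>)"
    by measurable
  then show ?thesis
    unfolding measurable_cong_sets[OF \<gamma> refl] case_prod_beta' .
qed

end

theory Submission
  imports Defs
begin

text \<open>
  Let \<open>\<gamma>\<close> couple a measure \<open>\<mu>\<close>, equivalent to Lebesgue measure on \<open>\<Omega>\<close>, with a measure supported
  on \<open>V\<close>, and let \<open>r\<close> be the essential supremum of the distance under \<open>\<gamma>\<close>. Almost every point of
  \<open>\<Omega>\<close> then lies within \<open>r\<close> of some point of \<open>V\<close>. So the union of the closed balls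
  of radius \<open>r\<close> about \<open>V\<close> misses only a Lebesgue null subset of \<open>\<Omega>\<close>; as \<open>V\<close> is finite, the missed
  part is also open, hence empty (\<open>cballs_cover_of_coupling\<close>).

  If the graph with edge length \<open>2 * r\<close> were disconnected, \<open>V\<close> would split into two nonempty parts
  at distance greater than \<open>2 * r\<close>. The balls about one part would be disjoint from those about the
  other, and the two unions would separate \<open>\<Omega>\<close> into nonempty relatively closed pieces, against the
  connectedness of the convex set \<open>\<Omega>\<close> (\<open>connected_geometric_graph_of_cover\<close>).

  Hence the threshold is at most \<open>2 * r\<close>, and \<open>1 \<le> sqrt d\<close>.
\<close>

text \<open>
  The vertices reachable from a fixed vertex form a set with no edge leaving it. If some vertex were
  unreachable, this set and its complement would be a cut that no edge crosses.
\<close>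

lemma connected_geometric_graphI:
  fixes V :: "'a::metric_space set"
  assumes "V \<noteq> {}"
    and cut: "\<And>A B. A \<noteq> {} \<Longrightarrow> B \<noteq> {} \<Longrightarrow> A \<union> B = V \<Longrightarrow> A \<inter> B = {} \<Longrightarrow> \<exists>a\<in>A. \<exists>b\<in>B. dist a b \<le> s"
  shows "Digraph_Component.connected (with_proj (geometric_graph s V))"
proof -
  let ?G = "with_proj (geometric_graph s V)"
  let ?R = "(arcs_ends ?G)\<^sup>s"
  have verts: "verts ?G = V"
    by (simp add: geometric_graph_def)
  have edge: "(a, b) \<in> ?R" if "a \<in> V" "b \<in> V" "a \<noteq> b" "dist a b \<le> s" for a b
    using that by (auto simp: symcl_def arcs_ends_def arc_to_ends_def geometric_graph_def)
  have "(u, v) \<in> rtrancl_on V ?R" if "u \<in> V" "v \<in> V" for u v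
  proof (rule ccontr)
    assume unreachable: "(u, v) \<notin> rtrancl_on V ?R"
    define A where "A = {w \<in> V. (u, w) \<in> rtrancl_on V ?R}"
    have "u \<in> A" "v \<in> V - A"
      using that unreachable by (auto simp: A_def)
    then obtain a b where ab: "a \<in> A" "b \<in> V - A" "dist a b \<le> s"
      using cut[of A "V - A"] by (auto simp: A_def)
    then have "(u, a) \<in> rtrancl_on V ?R" "(a, b) \<in> ?R"
      using edge[of a b] by (auto simp: A_def)
    then have "(u, b) \<in> rtrancl_on V ?R"
      using ab by (blast intro: rtrancl_on_into_rtrancl_on)
    with ab show False
      by (auto simp: A_def)
  qed
  with \<open>V \<noteq> {}\<close> show ?thesis
    unfolding Digraph_Component.connected_conv verts by blast
qed

text \<open>
  If all distances across a cut of \<open>V\<close> were greater than \<open>2 * r\<close>, no ball about one side would meet a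
  ball about the other, by the triangle inequality. The two closed unions of balls would then
  separate \<open>\<Omega>\<close>, each meeting it in its centres.
\<close>

lemma connected_geometric_graph_of_cover:
  fixes \<Omega> V :: "'a::metric_space set"
  assumes conn: "Topological_Spaces.connected \<Omega>" and "V \<subseteq> \<Omega>" "finite V" "V \<noteq> {}" and "0 \<le> r"
    and cover: "\<Omega> \<subseteq> (\<Union>v\<in>V. cball v r)"
  shows "Digraph_Component.connected (with_proj (geometric_graph (2 * r) V))"
proof (rule connected_geometric_graphI[OF \<open>V \<noteq> {}\<close>], rule ccontr)
  fix A B
  assume AB: "A \<noteq> {}" "B \<noteq> {}" "A \<union> B = V"
    and far: "\<not> (\<exists>a\<in>A. \<exists>b\<in>B. dist a b \<le> 2 * r)"
  let ?U = "\<lambda>S. \<Union>v\<in>S. cball v r"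
  have "finite A" "finite B"
    using AB \<open>finite V\<close> by auto
  then have "closed (?U A)" "closed (?U B)"
    by (auto intro: closed_UN)
  moreover have "?U A \<inter> ?U B = {}"
  proof -
    have "dist a b \<le> 2 * r" if "dist a x \<le> r" "dist b x \<le> r" for a b x :: 'a
      using that dist_triangle2[of a b x] by linarith
    with far show ?thesis
      by (auto simp: disjoint_iff) blast
  qed
  moreover have "\<Omega> \<subseteq> ?U A \<union> ?U B"
    using cover AB by auto
  moreover have "A \<subseteq> ?U A \<inter> \<Omega>" "B \<subseteq> ?U B \<inter> \<Omega>"
    using AB \<open>V \<subseteq> \<Omega>\<close> \<open>0 \<le> r\<close> by auto
  ultimately show False
    using connected_closedD[OF conn, of "?U A" "?U B"] AB by auto
qed

text \<open>
  The coupling shows that the uncovered part of \<open>\<Omega>\<close> is \<open>\<mu>\<close>-null. Sets that are \<open>\<mu>\<close>-null are Lebesgue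
  null, so \<open>\<mu>\<close> cannot ignore a nonempty open part of \<open>\<Omega>\<close>, and the uncovered part is open because
  finitely many closed balls have a closed union.
\<close>

lemma cballs_cover_of_coupling:
  fixes \<Omega> V :: "'a::euclidean_space set"
  assumes "open \<Omega>" "finite V"
    and \<mu>: "\<mu> \<in> equivalent_prob_measures \<Omega>" and \<nu>: "\<nu> \<in> supported_prob_measures \<Omega> V"
    and \<gamma>: "\<gamma> \<in> couplings \<mu> \<nu>"
    and r: "esssup \<gamma> (\<lambda>(x, y). ennreal (dist x y)) = ennreal r" "0 \<le> r"
  shows "\<Omega> \<subseteq> (\<Union>v\<in>V. cball v r)"
proof -
  define N where "N = \<Omega> - (\<Union>v\<in>V. cball v r)"
  have "open N"
    unfolding N_def using \<open>open \<Omega>\<close> \<open>finite V\<close> by (intro open_Diff closed_UN) auto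
  have \<mu>': "\<mu> \<in> borel_prob_measures \<Omega>"
    and ac: "absolutely_continuous \<mu> (restrict_space lborel \<Omega>)"
    using \<mu> by (auto simp: equivalent_prob_measures_def)
  have sets_\<mu>: "sets \<mu> = sets (restrict_space borel \<Omega>)"
    using \<mu>' by (auto simp: borel_prob_measures_def)
  have sets_\<gamma>: "sets \<gamma> = sets (\<mu> \<Otimes>\<^sub>M \<nu>)" and fst_\<gamma>: "distr \<gamma> \<mu> fst = \<mu>" and snd_\<gamma>: "distr \<gamma> \<nu> snd = \<nu>"
    using \<gamma> by (auto simp: couplings_def)
  have [measurable]: "fst \<in> measurable \<gamma> \<mu>" "snd \<in> measurable \<gamma> \<nu>"
    by (simp_all cong: measurable_cong_sets[OF sets_\<gamma> refl])
  have "AE p in \<gamma>. snd p \<in> V"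
    using \<nu> by (intro AE_distrD[of snd \<gamma> \<nu> "\<lambda>y. y \<in> V"])
      (auto simp only: snd_\<gamma> supported_prob_measures_def \<open>snd \<in> measurable \<gamma> \<nu>\<close>)
  moreover have "AE p in \<gamma>. dist (fst p) (snd p) \<le> r"
    using esssup_AE[of "\<lambda>(x, y). ennreal (dist x y)" \<gamma>] r by (simp add: case_prod_beta')
  ultimately have near: "AE p in \<gamma>. fst p \<notin> N"
    by eventually_elim (auto simp: N_def dist_commute)
  have "N \<in> sets \<mu>"
    using \<open>open N\<close> \<open>open \<Omega>\<close> by (auto simp: sets_\<mu> sets_restrict_space_iff N_def)
  then have "AE x in distr \<gamma> \<mu> fst. x \<notin> N"
    using near by (subst AE_distr_iff) auto
  then have "AE x in \<mu>. x \<notin> N"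
    unfolding fst_\<gamma> .
  then have "N \<in> null_sets \<mu>"
    using \<open>N \<in> sets \<mu>\<close> by (simp add: AE_iff_null_sets)
  then have "N \<in> null_sets (restrict_space lborel \<Omega>)"
    using ac by (auto simp: absolutely_continuous_def)
  then have "N \<in> null_sets lborel"
    using \<open>open \<Omega>\<close> by (simp add: null_sets_restrict_space)
  then have "negligible N"
    by (simp add: negligible_iff_null_sets null_sets_completionI)
  then have "N = {}"
    using \<open>open N\<close> open_not_negligible by blast
  then show ?thesis
    by (auto simp: N_def)
qed

theorem corollary4p9:
  fixes \<Omega> V :: "(real ^ 'd) set"
  assumes "open \<Omega>" and "bounded \<Omega>" and "lipschitz_boundary \<Omega>"
    and "convex \<Omega>"
    and "V \<subseteq> \<Omega>" and "finite V"
  shows "connectivity_threshold V \<le>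
    ennreal (2 * sqrt (real CARD('d))) *
      (INF \<mu> \<in> equivalent_prob_measures \<Omega>. INF \<nu> \<in> supported_prob_measures \<Omega> V.
         wasserstein_infinity \<mu> \<nu>)"
proof -
  let ?c = "ennreal (2 * sqrt (real CARD('d)))"
  let ?essdist = "\<lambda>\<gamma>. esssup \<gamma> (\<lambda>(x, y). ennreal (dist x y))"
  have card: "1 \<le> sqrt (real CARD('d))"
    by (simp add: Suc_le_eq)
  have bound: "connectivity_threshold V \<le> ?c * ?essdist \<gamma>"
    if \<mu>: "\<mu> \<in> equivalent_prob_measures \<Omega>" and \<nu>: "\<nu> \<in> supported_prob_measures \<Omega> V"
      and \<gamma>: "\<gamma> \<in> couplings \<mu> \<nu>" for \<mu> \<nu> \<gamma>
  proof (cases "?essdist \<gamma>")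
    case (real r)
    have "prob_space \<nu>" "AE x in \<nu>. x \<in> V"
      using \<nu> by (auto simp: supported_prob_measures_def borel_prob_measures_def)
    (* The graph without vertices is not connected, so the case of empty V must be excluded: V
       supports no probability measure then. *)
    then have "V \<noteq> {}"
      using prob_space.AE_False by fastforce
    have "\<Omega> \<subseteq> (\<Union>v\<in>V. cball v r)"
      using cballs_cover_of_coupling[OF \<open>open \<Omega>\<close> \<open>finite V\<close> \<mu> \<nu> \<gamma>] real by blast
    then have "Digraph_Component.connected (with_proj (geometric_graph (2 * r) V))"
      using connected_geometric_graph_of_cover convex_connected[OF \<open>convex \<Omega>\<close>] \<open>V \<subseteq> \<Omega>\<close> \<open>finite V\<close>
        \<open>V \<noteq> {}\<close> real by blast
    then have "connectivity_threshold V \<le> ennreal (2 * r)"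
      unfolding connectivity_threshold_def using real
      by (intro Inf_lower) (auto intro!: exI[of _ "2 * r"])
    also have "\<dots> \<le> ennreal (2 * sqrt (real CARD('d)) * r)"
      using card real by (intro ennreal_leI mult_right_mono) auto
    also have "\<dots> = ?c * ?essdist \<gamma>"
      using real by (simp add: ennreal_mult)
    finally show ?thesis .
  next
    case top
    then show ?thesis
      using card by (simp add: ennreal_mult_top)
  qed
  (* Dividing by the positive finite constant moves it off the infima, where a lower bound can be
     checked coupling by coupling; infima over empty sets are infinite and need no coupling. *)
  have c: "?c \<noteq> 0" "?c \<noteq> \<top>"
    using card by auto
  then have "connectivity_threshold V / ?c \<le>
      (INF \<mu> \<in> equivalent_prob_measures \<Omega>. INF \<nu> \<in> supported_prob_measures \<Omega> V.
         wasserstein_infinity \<mu> \<nu>)" (is "_ \<le> ?inf")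
    unfolding wasserstein_infinity_def
    by (intro INF_greatest divide_le_posI_ennreal bound) (auto simp: zero_less_iff_neq_zero)
  then have "?c * (connectivity_threshold V / ?c) \<le> ?c * ?inf"
    by (rule mult_left_mono) simp
  moreover have "?c * (connectivity_threshold V / ?c) = connectivity_threshold V"
    using c by (metis ennreal_times_divide mult.commute mult_divide_eq_ennreal)
  ultimately show ?thesis
    by simp
qed

end
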